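(* Let $W_1$ and $W_2$ be two matrix weights on the same interval, of sizes $N_1$ and $N_2$. Write a differential operator $D$ with coefficients in $\mathrm{Mat}_{N_1+N_2}(\mathbb C)[x]$ in block form $D=\begin{pmatrix} D_{11} & D_{12} \\ D_{21} & D_{22} \end{pmatrix}$ with $D_{ij}$ of size $N_i\times N_j$. Then $$\mathcal D(W_1\oplus W_2)=\begin{pmatrix}\mathcal D(W_1)&\mathcal D(W_1,W_2)\\ \mathcal D(W_2,W_1)&\mathcal D(W_2)\end{pmatrix},$$ i.e. $D\in\mathcal D(W_1\oplus W_2)$ if and only if $D_{11}\in\mathcal D(W_1)$, $D_{22}\in\mathcal D(W_2)$, $D_{12}\in\mathcal D(W_1,W_2)$ and $D_{21}\in\mathcal D(W_2,W_1)$.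
   Context: A matrix weight of size $N$ on an interval $(a,b)\subseteq\mathbb R$ is an integrable function $W:(a,b)\to\mathrm{Mat}_N(\mathbb C)$ such that $W(x)$ is positive semidefinite for all $x\in(a,b)$, positive definite for almost every $x$, and with finite moments $\int_a^b x^nW(x)\,dx$ of all orders $n\ge0$. $W_1\oplus W_2$ is the block diagonal weight with blocks $W_1,W_2$. A sequence of orthogonal polynomials $\{Q_n\}_{n\ge0}$ for $W$ consists of $Q_n\in\mathrm{Mat}_N(\mathbb C)[x]$ of degree $n$ with nonsingular leading coefficient and $\int_a^b Q_n(x)W(x)Q_m(x)^*dx=0$ for $n\ne m$; the monic orthogonal polynomials are the unique such sequence with leading coefficients $I$. Differential operators act on the right: $D=\sum_{i=0}^s\partial^iF_i(x)$, $\partial=\frac{d}{dx}$, acts on a matrix polynomial $Q$ by $QD=\sum_{i=0}^s\partial^i(Q)(x)F_i(x)$. For a matrix weight $W$ of size $N$, $$\mathcal D(W)=\{D=\textstyle\sum_i\partial^iF_i,\ F_i\in\mathrm{Mat}_N(\mathbb C)[x]: \forall n\ge0\ \exists\,\Gamma_n(D)\in\mathrm{Mat}_N(\mathbb C),\ Q_nD=\Gamma_n(D)Q_n\},$$ which does not depend on the choice of orthogonal sequence $\{Q_n\}$. Let $\{P_n\}$ and $\{Q_n\}$ be the sequences of monic orthogonal polynomials of $W_1$ and $W_2$ respectively, and let $\mathcal D_{N_1\times N_2}=\{D=\sum_i\partial^iF_i: F_i\in\mathrm{Mat}_{N_1\times N_2}(\mathbb C)[x],\ \deg F_i\le i\}$.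 Define $$\mathcal D(W_1,W_2)=\{D\in\mathcal D_{N_1\times N_2}: \forall n\ge 0\ \exists\,\Lambda_n(D)\in\mathrm{Mat}_{N_1\times N_2}(\mathbb C),\ P_nD=\Lambda_n(D)Q_n\},$$ $$\mathcal D(W_2,W_1)=\{D\in\mathcal D_{N_2\times N_1}: \forall n\ge 0\ \exists\,\Lambda_n(D)\in\mathrm{Mat}_{N_2\times N_1}(\mathbb C),\ Q_nD=\Lambda_n(D)P_n\}.$$ *)

theory Defs
  imports "HOL-Analysis.Analysis" "HOL-Computational_Algebra.Polynomial"
begin

section \<open>Matrices\<close>

(* Matrices of size m x n over R are of type R^'n^'m, with 'm and 'n finite types;
   thus N_1 + N_2 is the index type 'n1 + 'n2. *)

definition ctranspose :: "complex^'n^'m \<Rightarrow> complex^'m^'n" where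
  "ctranspose A = map_matrix cnj (transpose A)"

definition cquad_form :: "complex^'n^'n \<Rightarrow> complex^'n \<Rightarrow> complex" where
  "cquad_form A v = (\<Sum>i\<in>UNIV. cnj (v $ i) * (A *v v) $ i)"

definition pos_semidef :: "complex^'n^'n \<Rightarrow> bool" where
  "pos_semidef A \<longleftrightarrow> ctranspose A = A \<and> (\<forall>v. 0 \<le> Re (cquad_form A v))"

definition pos_def :: "complex^'n^'n \<Rightarrow> bool" where
  "pos_def A \<longleftrightarrow> ctranspose A = A \<and> (\<forall>v. v \<noteq> 0 \<longrightarrow> 0 < Re (cquad_form A v))"

definition block11 :: "'a^('n1::finite + 'n2::finite)^('n1 + 'n2) \<Rightarrow> 'a^'n1^'n1" where
  "block11 A = (\<chi> i j. A $ Inl i $ Inl j)"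

definition block12 :: "'a^('n1::finite + 'n2::finite)^('n1 + 'n2) \<Rightarrow> 'a^'n2^'n1" where
  "block12 A = (\<chi> i j. A $ Inl i $ Inr j)"

definition block21 :: "'a^('n1::finite + 'n2::finite)^('n1 + 'n2) \<Rightarrow> 'a^'n1^'n2" where
  "block21 A = (\<chi> i j. A $ Inr i $ Inl j)"

definition block22 :: "'a^('n1::finite + 'n2::finite)^('n1 + 'n2) \<Rightarrow> 'a^'n2^'n2" where
  "block22 A = (\<chi> i j. A $ Inr i $ Inr j)"

definition block_diag :: "'a::zero^'n1^'n1 \<Rightarrow> 'a^'n2^'n2 \<Rightarrow> 'a^('n1::finite + 'n2::finite)^('n1 + 'n2)" where
  "block_diag A B = (\<chi> i j. case (i, j) of
      (Inl k, Inl l) \<Rightarrow> A $ k $ l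
    | (Inr k, Inr l) \<Rightarrow> B $ k $ l
    | _ \<Rightarrow> 0)"


section \<open>Matrix polynomials\<close>

(* Mat_{m x n}(C)[x] is represented by matrices with polynomial entries, so that
   the product of matrix polynomials is the library's matrix product **. *)

type_synonym ('m, 'n) matrix_poly = "complex poly^'n^'m"

definition mat_const :: "complex^'n^'m \<Rightarrow> ('m::finite, 'n::finite) matrix_poly" where
  "mat_const A = map_matrix (\<lambda>c. [:c:]) A"

definition mat_eval :: "('m::finite, 'n::finite) matrix_poly \<Rightarrow> real \<Rightarrow> complex^'n^'m" where
  "mat_eval P x = map_matrix (\<lambda>p. poly p (of_real x)) P"

definition mat_coeff :: "('m::finite, 'n::finite) matrix_poly \<Rightarrow> nat \<Rightarrow> complex^'n^'m" where
  "mat_coeff P k = map_matrix (\<lambda>p. coeff p k) P"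

definition mat_degree :: "('m::finite, 'n::finite) matrix_poly \<Rightarrow> nat" where
  "mat_degree P = Max (range (\<lambda>(i, j). degree (P $ i $ j)))"

definition mat_deriv :: "('m::finite, 'n::finite) matrix_poly \<Rightarrow> ('m, 'n) matrix_poly" where
  "mat_deriv P = map_matrix pderiv P"


section \<open>Matrix weights and orthogonal polynomials\<close>

(* The endpoints may be infinite.  Integrability of W itself is the case n = 0. *)
definition matrix_weight :: "ereal \<Rightarrow> ereal \<Rightarrow> (real \<Rightarrow> complex^'n^'n) \<Rightarrow> bool" where
  "matrix_weight a b W \<longleftrightarrow>
     a < b \<and>
     (\<forall>x\<in>einterval a b. pos_semidef (W x)) \<and>
     (AE x in lebesgue. x \<in> einterval a b \<longrightarrow> pos_def (W x)) \<and>
     (\<forall>n::nat. set_integrable lebesgue (einterval a b) (\<lambda>x. x ^ n *\<^sub>R W x))"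

definition weight_sum ::
    "(real \<Rightarrow> complex^'n1^'n1) \<Rightarrow> (real \<Rightarrow> complex^'n2^'n2) \<Rightarrow>
     real \<Rightarrow> complex^('n1::finite + 'n2::finite)^('n1 + 'n2)" where
  "weight_sum W1 W2 = (\<lambda>x. block_diag (W1 x) (W2 x))"

definition orthogonal_polys ::
    "ereal \<Rightarrow> ereal \<Rightarrow> (real \<Rightarrow> complex^'n^'n) \<Rightarrow> (nat \<Rightarrow> ('n::finite, 'n) matrix_poly) \<Rightarrow> bool" where
  "orthogonal_polys a b W Q \<longleftrightarrow>
     (\<forall>n. mat_degree (Q n) = n \<and> invertible (mat_coeff (Q n) n)) \<and>
     (\<forall>n m. n \<noteq> m \<longrightarrow>
        (LINT x:einterval a b|lebesgue.
           mat_eval (Q n) x ** W x ** ctranspose (mat_eval (Q m) x)) = 0)"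

definition monic_orthogonal_polys ::
    "ereal \<Rightarrow> ereal \<Rightarrow> (real \<Rightarrow> complex^'n^'n) \<Rightarrow> nat \<Rightarrow> ('n::finite, 'n) matrix_poly" where
  "monic_orthogonal_polys a b W =
     (THE Q. orthogonal_polys a b W Q \<and> (\<forall>n. mat_coeff (Q n) n = mat 1))"


section \<open>Differential operators\<close>

(* The operator sum_i d^i F_i(x) is represented by the finitely supported sequence of its
   coefficients, as the formal polynomial in d with coeff D i = F_i.  Only the additive
   structure of the outer type poly is used: composition of operators is not its product. *)

type_synonym ('m, 'n) matrix_diff_op = "('m, 'n) matrix_poly poly"

(* The right action Q D = sum_i d^i(Q) F_i. *)
definition op_apply ::
    "('k::finite, 'm::finite) matrix_poly \<Rightarrow> ('m, 'n::finite) matrix_diff_op \<Rightarrow> ('k, 'n) matrix_poly" where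
  "op_apply Q D = (\<Sum>i\<le>degree D. (mat_deriv ^^ i) Q ** coeff D i)"

(* The algebra of W does not depend on the orthogonal sequence Q, which
   is therefore quantified over all of them. *)
definition diff_alg ::
    "ereal \<Rightarrow> ereal \<Rightarrow> (real \<Rightarrow> complex^'n^'n) \<Rightarrow> ('n::finite, 'n) matrix_diff_op set" where
  "diff_alg a b W =
     {D. \<forall>Q. orthogonal_polys a b W Q \<longrightarrow>
           (\<forall>n. \<exists>\<Gamma>. op_apply (Q n) D = mat_const \<Gamma> ** Q n)}"

definition degree_bounded_ops :: "('m::finite, 'n::finite) matrix_diff_op set" where
  "degree_bounded_ops = {D. \<forall>i. mat_degree (coeff D i) \<le> i}"


definition diff_mod ::
    "ereal \<Rightarrow> ereal \<Rightarrow> (real \<Rightarrow> complex^'n1^'n1) \<Rightarrow> (real \<Rightarrow> complex^'n2^'n2) \<Rightarrow>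
     ('n1::finite, 'n2::finite) matrix_diff_op set" where
  "diff_mod a b W1 W2 =
     {D \<in> degree_bounded_ops.
        \<forall>n. \<exists>\<Lambda>. op_apply (monic_orthogonal_polys a b W1 n) D =
                 mat_const \<Lambda> ** monic_orthogonal_polys a b W2 n}"

end

theory Submission
  imports Defs
begin

text \<open>The monic orthogonal polynomials of \<open>W\<^sub>1 \<oplus> W\<^sub>2\<close> are the block diagonal matrices of those of
  \<open>W\<^sub>1\<close> and \<open>W\<^sub>2\<close>, by uniqueness, so the eigenvalue equation for \<open>D\<close> splits into one equation
  for each block. What remains are the degree bounds built into \<open>\<D>(W\<^sub>1, W\<^sub>2)\<close>: an operator
  that maps \<open>P\<^sub>n\<close> to \<open>\<Lambda>\<^sub>n Q\<^sub>n\<close> for all \<open>n\<close> does not raise degrees on the \<open>P\<^sub>n\<close>, and by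
  induction on \<open>i\<close> this forces \<open>deg F\<^sub>i \<le> i\<close>.\<close>

section \<open>Matrices and matrix polynomials\<close>

lemma mat_coeff_nth [simp]: "mat_coeff P k $ i $ j = coeff (P $ i $ j) k"
  by (simp add: mat_coeff_def map_matrix_def)

lemma mat_eval_nth [simp]: "mat_eval P x $ i $ j = poly (P $ i $ j) (of_real x)"
  by (simp add: mat_eval_def map_matrix_def)

lemma mat_const_nth [simp]: "mat_const A $ i $ j = [:A $ i $ j:]"
  by (simp add: mat_const_def map_matrix_def)

lemma ctranspose_nth [simp]: "ctranspose A $ i $ j = cnj (A $ j $ i)"
  by (simp add: ctranspose_def map_matrix_def transpose_def)

lemma mat_deriv_power_nth [simp]: "(mat_deriv ^^ n) P $ i $ j = (pderiv ^^ n) (P $ i $ j)"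
  by (induction n arbitrary: P) (simp_all add: mat_deriv_def map_matrix_def)

lemma matrix_mult_nth: "(A ** B) $ i $ j = (\<Sum>k\<in>UNIV. A $ i $ k * B $ k $ j)"
  by (simp add: matrix_matrix_mult_def)

lemma matrix_poly_eqI:
  assumes "\<And>k. mat_coeff P k = mat_coeff Q k"
  shows "P = Q"
  using assms by (simp add: vec_eq_iff poly_eq_iff)

lemma mat_coeff_const_mult: "mat_coeff (mat_const C ** P) k = C ** mat_coeff P k"
  by (simp add: vec_eq_iff matrix_mult_nth coeff_sum)

lemma mat_const_mult: "mat_const (A ** B) = mat_const A ** mat_const B"
  by (rule matrix_poly_eqI) (simp add: mat_coeff_const_mult,
      simp add: vec_eq_iff matrix_mult_nth coeff_pCons sum_distrib_left split: nat.split)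

lemma mat_const_one [simp]: "mat_const (mat 1) = mat 1"
  by (simp add: vec_eq_iff mat_def one_pCons)

lemma mat_eval_const_mult: "mat_eval (mat_const C ** P) x = C ** mat_eval P x"
  by (simp add: vec_eq_iff matrix_mult_nth poly_sum)

lemma mat_coeff_diff: "mat_coeff (P - Q) k = mat_coeff P k - mat_coeff Q k"
  by (simp add: vec_eq_iff)

section \<open>Degrees and leading coefficients of matrix polynomials\<close>

lemma mat_degree_le_iff: "mat_degree P \<le> n \<longleftrightarrow> (\<forall>i j. degree (P $ i $ j) \<le> n)"
  unfolding mat_degree_def by (subst Max_le_iff) auto

lemma mat_degree_le_iff_coeff: "mat_degree P \<le> n \<longleftrightarrow> (\<forall>k>n. mat_coeff P k = 0)"
  unfolding mat_degree_le_iff vec_eq_iff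
  by (auto intro: degree_le coeff_eq_0 le_less_trans)

lemma mat_coeff_eq_0: "mat_degree P < k \<Longrightarrow> mat_coeff P k = 0"
  using mat_degree_le_iff_coeff[of P "mat_degree P"] by simp

lemma mat_degree_mult_le: "mat_degree (P ** Q) \<le> mat_degree P + mat_degree Q"
  unfolding mat_degree_le_iff matrix_mult_nth
proof (intro allI degree_sum_le)
  fix i j k
  have "degree (P $ i $ k * Q $ k $ j) \<le> degree (P $ i $ k) + degree (Q $ k $ j)"
    by (rule degree_mult_le)
  also have "\<dots> \<le> mat_degree P + mat_degree Q"
    using mat_degree_le_iff[of P "mat_degree P"] mat_degree_le_iff[of Q "mat_degree Q"]
    by (intro add_mono) auto
  finally show "degree (P $ i $ k * Q $ k $ j) \<le> mat_degree P + mat_degree Q" .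
qed simp

lemma mat_degree_deriv_power_le: "mat_degree ((mat_deriv ^^ n) P) \<le> mat_degree P - n"
  using mat_degree_le_iff[of P "mat_degree P"]
  by (auto simp: mat_degree_le_iff degree_higher_pderiv diff_le_mono)

text \<open>Phrased through coefficients, since these behave well under differences, constant left
  factors and block diagonals, whereas \<open>mat_degree\<close> is a maximum over entries.\<close>

definition monic_of_degree :: "nat \<Rightarrow> ('n::finite, 'n) matrix_poly \<Rightarrow> bool" where
  "monic_of_degree n P \<longleftrightarrow> mat_coeff P n = mat 1 \<and> (\<forall>k>n. mat_coeff P k = 0)"

lemma mat_one_neq_zero: "(mat 1 :: 'a::zero_neq_one^'n^'n) \<noteq> 0"
  by (simp add: vec_eq_iff mat_def)

lemma monic_of_degree_iff:
  "monic_of_degree n P \<longleftrightarrow> mat_degree P = n \<and> mat_coeff P n = mat 1"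
proof -
  have "mat_degree P = n" if "mat_degree P \<le> n" "mat_coeff P n = mat 1"
    using mat_coeff_eq_0[of P n] that mat_one_neq_zero by (metis le_neq_implies_less)
  then show ?thesis
    by (auto simp: monic_of_degree_def simp flip: mat_degree_le_iff_coeff)
qed

section \<open>Adjoints, linear maps on matrices and quadratic forms\<close>

lemma ctranspose_mult: "ctranspose (A ** B) = ctranspose B ** ctranspose A"
  by (simp add: vec_eq_iff matrix_mult_nth mult.commute)

lemma ctranspose_ctranspose [simp]: "ctranspose (ctranspose A) = A"
  by (simp add: vec_eq_iff)

lemma mat_eval_eq_sum: "mat_eval P x = (\<Sum>k\<le>mat_degree P. x ^ k *\<^sub>R mat_coeff P k)"
proof -
  have "poly (P $ i $ j) (complex_of_real x) =
        (\<Sum>k\<le>mat_degree P. complex_of_real x ^ k * coeff (P $ i $ j) k)" for i j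
    using mat_degree_le_iff[of P "mat_degree P"]
    unfolding poly_altdef
    by (intro sum.mono_neutral_cong_left) (auto simp: coeff_eq_0 not_le mult.commute)
  then show ?thesis
    by (simp add: vec_eq_iff scaleR_conv_of_real[where 'a = complex])
qed

lemma linear_matrix_mult_left: "linear (\<lambda>X :: complex^'n^'m. A ** X)"
  by (rule linearI) (simp_all add: vec_eq_iff matrix_mult_nth sum.distrib ring_distribs scaleR_sum_right)

lemma linear_matrix_mult_right: "linear (\<lambda>X :: complex^'n^'m. X ** A)"
  by (rule linearI) (simp_all add: vec_eq_iff matrix_mult_nth sum.distrib ring_distribs scaleR_sum_right)

lemma linear_ctranspose: "linear ctranspose"
  by (rule linearI) (simp_all add: vec_eq_iff)

lemma linear_cquad_form: "linear (\<lambda>A. cquad_form A v)"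
  by (rule linearI) 
    (simp_all add: cquad_form_def matrix_vector_mult_def sum.distrib ring_distribs
      flip: scaleR_sum_right)

text \<open>Moves the polynomial factors of the integrand P W P^* onto the vector, so that
  positivity of the weight applies pointwise.\<close>

lemma cquad_form_congruence:
  "cquad_form (A ** B ** ctranspose A) v = cquad_form B (ctranspose A *v v)"
proof -
  have "cquad_form (A ** B ** ctranspose A) v = 
     (\<Sum>i\<in>UNIV. \<Sum>k\<in>UNIV. cnj (v $ i) * A $ i $ k * (B *v (ctranspose A *v v)) $ k)"
    by (simp add: cquad_form_def matrix_vector_mul_assoc[symmetric] matrix_vector_mult_def[of A] 
        sum_distrib_left mult.assoc)
  also have "\<dots> = cquad_form B (ctranspose A *v v)"
    by (subst sum.swap)
      (simp add: cquad_form_def matrix_vector_mult_def[of "ctranspose A"] sum_distrib_right mult.commute)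
  finally show ?thesis .
qed

section \<open>The matrix-valued inner product of a weight\<close>

text \<open>The integral from the orthogonality condition, as a form that is linear over constant
  matrices acting on the left of \<open>P\<close>.\<close>

definition matrix_ip ::
  "ereal \<Rightarrow> ereal \<Rightarrow> (real \<Rightarrow> complex^'n^'n) \<Rightarrow>
     ('m::finite, 'n::finite) matrix_poly \<Rightarrow> ('k::finite, 'n) matrix_poly \<Rightarrow> complex^'k^'m"
  where "matrix_ip a b W P Q =
    (LINT x:einterval a b|lebesgue. mat_eval P x ** W x ** ctranspose (mat_eval Q x))"

text \<open>On a finite-dimensional space a linear map is bounded, hence commutes with the
  integral.\<close>

lemma set_integrable_linear_image:
  fixes f :: "'x \<Rightarrow> 'v::euclidean_space" and T :: "'v \<Rightarrow> 'w::{banach, second_countable_topology}"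
  assumes "linear T" and "set_integrable M A f"
  shows "set_integrable M A (\<lambda>x. T (f x))"
    and "(LINT x:A|M. T (f x)) = T (LINT x:A|M. f x)"
proof -
  interpret T: bounded_linear T
    using assms(1) by (simp add: linear_conv_bounded_linear)
  have *: "(\<lambda>x. T (indicator A x *\<^sub>R f x)) = (\<lambda>x. indicator A x *\<^sub>R T (f x))"
    by (simp add: T.scaleR)
  show "set_integrable M A (\<lambda>x. T (f x))"
    using integrable_bounded_linear[OF T.bounded_linear_axioms assms(2)[unfolded set_integrable_def]]
    unfolding * by (simp add: set_integrable_def)
  show "(LINT x:A|M. T (f x)) = T (LINT x:A|M. f x)"
    using integral_bounded_linear[OF T.bounded_linear_axioms assms(2)[unfolded set_integrable_def]]
    unfolding * by (simp add: set_lebesgue_integral_def)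
qed

lemma set_integrable_sum:
  fixes f :: "'i \<Rightarrow> 'x \<Rightarrow> 'v::{banach, second_countable_topology}"
  assumes "\<And>i. i \<in> I \<Longrightarrow> set_integrable M A (f i)"
  shows "set_integrable M A (\<lambda>x. \<Sum>i\<in>I. f i x)"
  using assms unfolding set_integrable_def scaleR_sum_right by (rule Bochner_Integration.integrable_sum)

text \<open>Expanding both polynomials in powers of the real variable writes the integrand as a
  finite sum of fixed linear images of the moment integrands x^(i+j) W(x).\<close>

lemma matrix_weight_ip_integrable:
  assumes "matrix_weight a b W"
  shows "set_integrable lebesgue (einterval a b)
    (\<lambda>x. mat_eval P x ** W x ** ctranspose (mat_eval Q x))"
proof -
  have lin: "linear (\<lambda>X. mat_coeff P i ** X ** ctranspose (mat_coeff Q j))" for i j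
    using linear_compose[OF linear_matrix_mult_left linear_matrix_mult_right] by (simp add: o_def)
  have "set_integrable lebesgue (einterval a b) (\<lambda>x. x ^ n *\<^sub>R W x)" for n
    using assms by (simp add: matrix_weight_def)
  then have int: "set_integrable lebesgue (einterval a b)
      (\<lambda>x. mat_coeff P i ** (x ^ (i + j) *\<^sub>R W x) ** ctranspose (mat_coeff Q j))" for i j
    by (rule set_integrable_linear_image(1)[OF lin])
  have "mat_eval P x ** W x ** ctranspose (mat_eval Q x) =
    (\<Sum>i\<le>mat_degree P. \<Sum>j\<le>mat_degree Q.
       mat_coeff P i ** (x ^ (i + j) *\<^sub>R W x) ** ctranspose (mat_coeff Q j))" for x
  proof -
    have "mat_eval P x ** W x ** ctranspose (mat_eval Q x) =
       (\<Sum>i\<le>mat_degree P. x ^ i *\<^sub>R (mat_coeff P i ** (W x ** ctranspose (mat_eval Q x))))"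
      unfolding mat_eval_eq_sum[of P] matrix_mul_assoc
      by (simp add: linear_sum[OF linear_matrix_mult_right] linear_scale[OF linear_matrix_mult_right]
          flip: matrix_mul_assoc)
    also have "\<dots> = (\<Sum>i\<le>mat_degree P. \<Sum>j\<le>mat_degree Q.
       mat_coeff P i ** (x ^ (i + j) *\<^sub>R W x) ** ctranspose (mat_coeff Q j))"
      unfolding mat_eval_eq_sum[of Q]
      by (simp add: linear_sum[OF linear_ctranspose] linear_scale[OF linear_ctranspose]
         linear_sum[OF linear_matrix_mult_left] linear_scale[OF linear_matrix_mult_left]
         linear_scale[OF linear_matrix_mult_right] scaleR_sum_right power_add flip: matrix_mul_assoc)
    finally show ?thesis .
  qed
  then show ?thesis
    using int by (simp add: set_integrable_sum)
qed

lemma matrix_ip_const_left: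
  assumes "matrix_weight a b W"
  shows "matrix_ip a b W (mat_const C ** P) Q = C ** matrix_ip a b W P Q"
  using set_integrable_linear_image(2)[OF linear_matrix_mult_left matrix_weight_ip_integrable[OF assms]]
  by (simp add: matrix_ip_def mat_eval_const_mult flip: matrix_mul_assoc)

lemma mat_eval_diff: "mat_eval (P - Q) x = mat_eval P x - mat_eval Q x"
  by (simp add: vec_eq_iff)

lemma matrix_ip_diff_left:
  assumes "matrix_weight a b W"
  shows "matrix_ip a b W (P - Q) R = matrix_ip a b W P R - matrix_ip a b W Q R"
  using set_integral_diff(2)[OF matrix_weight_ip_integrable[OF assms, of P R]
      matrix_weight_ip_integrable[OF assms, of Q R]]
  by (simp add: matrix_ip_def mat_eval_diff linear_diff[OF linear_matrix_mult_right])

lemma matrix_ip_hermitian: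
  assumes "matrix_weight a b W"
  shows "matrix_ip a b W Q P = ctranspose (matrix_ip a b W P Q)"
proof -
  have "ctranspose (W x) = W x" if "x \<in> einterval a b" for x
    using assms that by (auto simp: matrix_weight_def pos_semidef_def)
  then have "matrix_ip a b W Q P = (LINT x:einterval a b|lebesgue.
     ctranspose (mat_eval P x ** W x ** ctranspose (mat_eval Q x)))"
    unfolding matrix_ip_def
    by (intro set_lebesgue_integral_cong) (auto simp: ctranspose_mult matrix_mul_assoc)
  then show ?thesis
    using set_integrable_linear_image(2)[OF linear_ctranspose matrix_weight_ip_integrable[OF assms]]
    by (simp add: matrix_ip_def)
qed

lemma matrix_ip_eq_0_commute:
  assumes "matrix_weight a b W" and "matrix_ip a b W P Q = 0"
  shows "matrix_ip a b W Q P = 0"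
  using matrix_ip_hermitian[OF assms(1), of Q P] assms(2) by (simp add: vec_eq_iff)

lemma matrix_ip_zero_left:
  assumes "matrix_weight a b W"
  shows "matrix_ip a b W 0 R = 0"
  using matrix_ip_diff_left[OF assms, of 0 0 R] by simp

text \<open>A nonempty open set has positive measure, and a finite set is null.\<close>

lemma einterval_minus_finite_not_negligible:
  assumes "a < b" "finite Z"
  shows "\<not> negligible (einterval a b - Z)"
proof -
  obtain x y where "a < ereal x" "x < y" "ereal y < b"
    by (metis assms(1) ereal_dense2 ereal_less_eq less_ereal.simps(1))
  then have "einterval a b \<noteq> {}"
    by (auto simp: einterval_def intro!: exI[of _ x] less_trans[of "ereal x" "ereal y" b])
  then have "\<not> negligible (einterval a b)"
    by (intro open_not_negligible) simp_all
  then show ?thesis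
    using negligible_Un[of "einterval a b - Z" Z] negligible_finite[OF assms(2)]
    by (metis Un_Diff_cancel2 Un_upper1 negligible_subset)
qed

text \<open>The quadratic form at \<open>v\<close> is the integral of (P^* v)^* W (P^* v), which is
  nonnegative. If the integral is 0, positive definiteness almost everywhere gives P(x)^* v = 0
  almost everywhere, so this polynomial vector vanishes identically.\<close>

lemma matrix_ip_definite:
  assumes W: "matrix_weight a b W"
    and 0: "cquad_form (matrix_ip a b W P P) v = 0"
  shows "ctranspose (mat_coeff P k) *v v = 0"
proof -
  let ?I = "einterval a b"
  let ?g = "\<lambda>x. Re (cquad_form (W x) (ctranspose (mat_eval P x) *v v))"
  have lin: "linear (\<lambda>A. Re (cquad_form A v))"
    using linear_compose[OF linear_cquad_form bounded_linear.linear[OF bounded_linear_Re]]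
    by (simp add: o_def)
  note integral = set_integrable_linear_image[OF lin matrix_weight_ip_integrable[OF W, of P P]]
  have g: "set_integrable lebesgue ?I ?g" and "(LINT x:?I|lebesgue. ?g x) = 0"
    using integral 0 by (simp_all add: cquad_form_congruence matrix_ip_def)
  then have "AE x in lebesgue. indicator ?I x *\<^sub>R ?g x = 0"
    using W unfolding set_lebesgue_integral_def set_integrable_def
    by (subst (asm) integral_nonneg_eq_0_iff_AE)
       (auto simp: matrix_weight_def pos_semidef_def indicator_def intro!: AE_I2)
  moreover have "AE x in lebesgue. x \<in> ?I \<longrightarrow> pos_def (W x)"
    using W by (simp add: matrix_weight_def)
  ultimately have AE: "AE x in lebesgue. x \<in> ?I \<longrightarrow> ctranspose (mat_eval P x) *v v = 0"
  proof eventually_elim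
    case (elim x)
    then show ?case
      by (auto simp: pos_def_def dest!: spec[of _ "ctranspose (mat_eval P x) *v v"])
  qed
  \<comment> \<open>a polynomial vanishing almost everywhere on an interval has infinitely many roots\<close>
  have "(\<Sum>i\<in>UNIV. smult (cnj (v $ i)) (P $ i $ l)) = 0" (is "?p = 0") for l
  proof (rule ccontr)
    assume p: "?p \<noteq> 0"
    define Z where "Z = {x :: real. poly ?p (of_real x) = 0}"
    have "finite (complex_of_real -` {z. poly ?p z = 0})"
      using poly_roots_finite[OF p] by (rule finite_vimageI) (simp add: inj_def)
    then have "finite Z"
      by (simp add: Z_def vimage_def)
    \<comment> \<open>The conjugated weights in \<open>?p\<close> make it, at real points, the
      conjugate of an entry of P(x)^* v; hence every point of \<open>?I - Z\<close> is exceptional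
      for \<open>AE\<close>.\<close>
    have "poly ?p (of_real x) = cnj ((ctranspose (mat_eval P x) *v v) $ l)" for x
      by (simp add: matrix_vector_mult_def poly_sum mult.commute)
    then have "AE x in lebesgue. x \<notin> ?I - Z"
      by (intro eventually_mono[OF AE]) (auto simp: Z_def)
    then have "negligible (?I - Z)"
      using \<open>finite Z\<close> unfolding negligible_iff_null_sets
      by (subst AE_iff_null_sets) (auto intro!: sets.Diff sets_completionI_sets finite_imp_closed borel_closed)
    then show False
      using einterval_minus_finite_not_negligible[OF _ \<open>finite Z\<close>] W
      by (auto simp: matrix_weight_def)
  qed
  then have "cnj (coeff (\<Sum>i\<in>UNIV. smult (cnj (v $ i)) (P $ i $ l)) k) = 0" for l
    by simp
  then show ?thesis
    by (simp add: vec_eq_iff matrix_vector_mult_def coeff_sum mult.commute)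
qed

section \<open>Existence and uniqueness of monic orthogonal polynomials\<close>

text \<open>A kernel vector has quadratic form 0, so it is killed by the adjoint of the leading
  coefficient, which is the identity.\<close>

lemma monic_matrix_ip_invertible:
  assumes W: "matrix_weight a b W" and P: "monic_of_degree n P"
  shows "invertible (matrix_ip a b W P P)"
proof -
  have "v = 0" if "matrix_ip a b W P P *v v = 0" for v
  proof -
    have "cquad_form (matrix_ip a b W P P) v = 0"
      by (simp add: cquad_form_def that)
    then have "ctranspose (mat_coeff P n) *v v = 0"
      by (rule matrix_ip_definite[OF W])
    moreover have "ctranspose (mat 1 :: complex^'a^'a) = mat 1"
      by (auto simp: vec_eq_iff mat_def)
    ultimately show ?thesis
      using P by (simp add: monic_of_degree_def)
  qed
  then show ?thesis
    by (simp add: invertible_left_inverse matrix_left_invertible_ker)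
qed

lemma matrix_ip_self_eq_0:
  assumes W: "matrix_weight a b W" and "matrix_ip a b W P P = 0"
  shows "P = 0"
proof (rule matrix_poly_eqI)
  fix k
  have "ctranspose (mat_coeff P k) *v v = 0 *v v" for v
    using matrix_ip_definite[OF W, of P v k] assms(2) by (simp add: cquad_form_def)
  then have "ctranspose (mat_coeff P k) = 0"
    unfolding matrix_eq by simp
  then show "mat_coeff P k = mat_coeff 0 k"
    by (simp add: vec_eq_iff)
qed

text \<open>Monic polynomials of degrees 0, ..., n-1 generate all polynomials of degree below n with
  constant matrix coefficients on the left; the induction peels off the top term.\<close>

lemma matrix_ip_lower_degree_eq_0:
  assumes W: "matrix_weight a b W"
    and "\<And>k. k < n \<Longrightarrow> monic_of_degree k (P k)"
    and "\<And>k. k < n \<Longrightarrow> matrix_ip a b W (P k) X = 0"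
    and "\<And>k. k \<ge> n \<Longrightarrow> mat_coeff R k = 0"
  shows "matrix_ip a b W R X = 0"
  using assms(2-4)
proof (induction n arbitrary: R)
  case 0
  then have "R = 0"
    by (intro matrix_poly_eqI) (simp add: vec_eq_iff)
  then show ?case
    using matrix_ip_zero_left[OF W] by simp
next
  case (Suc n)
  let ?S = "mat_const (mat_coeff R n) ** P n"
  have "mat_coeff (R - ?S) k = 0" if "k \<ge> n" for k
    using that Suc.prems(1)[of n] Suc.prems(3)[of k]
    by (cases "k = n") (simp_all add: mat_coeff_diff mat_coeff_const_mult monic_of_degree_def)
  then have "matrix_ip a b W (R - ?S) X = 0"
    by (intro Suc.IH Suc.prems) auto
  then show ?case
    using Suc.prems(2)[of n] by (simp add: matrix_ip_diff_left[OF W] matrix_ip_const_left[OF W])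
qed

text \<open>Orthogonality is required against every polynomial of lower degree, not against chosen
  predecessors. The property thus concerns a single \<open>n\<close>, as strong induction
  needs.\<close>

definition monic_orthogonal_to_lower ::
  "ereal \<Rightarrow> ereal \<Rightarrow> (real \<Rightarrow> complex^'n^'n) \<Rightarrow> nat \<Rightarrow> ('n::finite, 'n) matrix_poly \<Rightarrow> bool" where
  "monic_orthogonal_to_lower a b W n P \<longleftrightarrow> monic_of_degree n P \<and>
     (\<forall>R :: ('n, 'n) matrix_poly. (\<forall>k\<ge>n. mat_coeff R k = 0) \<longrightarrow> matrix_ip a b W R P = 0)"

text \<open>Gram-Schmidt with matrix coefficients; invertibility of the Gram matrices replaces
  division by squared norms.\<close>

lemma monic_orthogonal_to_lower_exists:
  assumes W: "matrix_weight a b W"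
  shows "\<exists>P. monic_orthogonal_to_lower a b W n P"
proof (induction n rule: less_induct)
  case (less n)
  then obtain P where P: "\<And>k. k < n \<Longrightarrow> monic_orthogonal_to_lower a b W k (P k)"
    by metis
  then have monic: "\<And>k. k < n \<Longrightarrow> monic_of_degree k (P k)"
    by (simp add: monic_orthogonal_to_lower_def)
  \<comment> \<open>Starting from x^n I, the projections onto the \<open>P k\<close> are removed one
    at a time.\<close>
  have "\<exists>X. monic_of_degree n X \<and> (\<forall>k<m. matrix_ip a b W X (P k) = 0)" if "m \<le> n" for m
    using that
  proof (induction m)
    case 0
    have "monic_of_degree n (mat (monom 1 n))"
      by (simp add: monic_of_degree_def vec_eq_iff mat_def)
    then show ?case by blast
  next
    case (Suc m)
    then obtain X where X: "monic_of_degree n X" "\<And>k. k < m \<Longrightarrow> matrix_ip a b W X (P k) = 0"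
      by auto
    let ?G = "matrix_ip a b W (P m) (P m)"
    have "m < n" using Suc.prems by simp
    then obtain H where "H ** ?G = mat 1"
      using monic_matrix_ip_invertible[OF W monic] by (auto simp: invertible_def)
    \<comment> \<open>The projection coefficient of \<open>X\<close> along \<open>P m\<close>, with
      \<open>H\<close> the inverse of the Gram matrix \<open>?G\<close>.\<close>
    let ?C = "matrix_ip a b W X (P m) ** H"
    let ?Y = "X - mat_const ?C ** P m"
    have "?C ** ?G = matrix_ip a b W X (P m)"
      using \<open>H ** ?G = mat 1\<close> by (simp flip: matrix_mul_assoc)
    then have m: "matrix_ip a b W ?Y (P m) = 0"
      by (simp add: matrix_ip_diff_left[OF W] matrix_ip_const_left[OF W])
    \<comment> \<open>The correction is a multiple of \<open>P m\<close>, which is orthogonal to the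
      earlier \<open>P k\<close>, so orthogonality already obtained survives.\<close>
    have "matrix_ip a b W ?Y (P k) = 0" if "k < m" for k
    proof -
      have "matrix_ip a b W (P k) (P m) = 0"
        using P[OF \<open>m < n\<close>] monic[of k] that \<open>m < n\<close>
        by (auto simp: monic_orthogonal_to_lower_def monic_of_degree_def)
      then have "matrix_ip a b W (P m) (P k) = 0"
        by (rule matrix_ip_eq_0_commute[OF W])
      then show ?thesis
        using X(2)[OF that] by (simp add: matrix_ip_diff_left[OF W] matrix_ip_const_left[OF W])
    qed
    with m have "\<forall>k<Suc m. matrix_ip a b W ?Y (P k) = 0"
      by (auto simp: less_Suc_eq)
    moreover have "monic_of_degree n ?Y"
      using X(1) monic[OF \<open>m < n\<close>] \<open>m < n\<close>
      by (simp add: monic_of_degree_def mat_coeff_diff mat_coeff_const_mult)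
    ultimately show ?case by blast
  qed
  then obtain X where X: "monic_of_degree n X" "\<And>k. k < n \<Longrightarrow> matrix_ip a b W X (P k) = 0"
    by blast
  have "matrix_ip a b W (P k) X = 0" if "k < n" for k
    using X(2)[OF that] by (rule matrix_ip_eq_0_commute[OF W])
  then show ?case
    using matrix_ip_lower_degree_eq_0[OF W monic, of n X] X(1)
    by (auto simp: monic_orthogonal_to_lower_def)
qed

lemma orthogonal_polys_alt:
  "orthogonal_polys a b W Q \<longleftrightarrow>
     (\<forall>n. mat_degree (Q n) = n \<and> invertible (mat_coeff (Q n) n)) \<and>
     (\<forall>n m. n \<noteq> m \<longrightarrow> matrix_ip a b W (Q n) (Q m) = 0)"
  by (simp add: orthogonal_polys_def matrix_ip_def)

lemma invertible_mat_1: "invertible (mat 1 :: complex^'n^'n)"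
  unfolding invertible_def by (rule exI[of _ "mat 1"]) simp

lemma orthogonal_monic_iff:
  "orthogonal_polys a b W P \<and> (\<forall>n. mat_coeff (P n) n = mat 1) \<longleftrightarrow>
     (\<forall>n. monic_of_degree n (P n)) \<and> (\<forall>n m. n \<noteq> m \<longrightarrow> matrix_ip a b W (P n) (P m) = 0)"
  unfolding orthogonal_polys_alt monic_of_degree_iff by (auto simp: invertible_mat_1)

lemma monic_orthogonal_exists:
  assumes W: "matrix_weight a b W"
  shows "\<exists>P. orthogonal_polys a b W P \<and> (\<forall>n. mat_coeff (P n) n = mat 1)"
proof -
  obtain P where P: "\<And>n. monic_orthogonal_to_lower a b W n (P n)"
    using monic_orthogonal_to_lower_exists[OF W] by metis
  then have monic: "monic_of_degree n (P n)" for n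
    by (simp add: monic_orthogonal_to_lower_def)
  have less: "matrix_ip a b W (P m) (P n) = 0" if "m < n" for m n
    using P[of n] monic[of m] that
    by (auto simp: monic_orthogonal_to_lower_def monic_of_degree_def)
  have "matrix_ip a b W (P m) (P n) = 0" if "m \<noteq> n" for m n
  proof (cases "m < n")
    case False
    then show ?thesis
      using less[of n m] matrix_ip_eq_0_commute[OF W, of "P n" "P m"] that by simp
  qed (rule less)
  with monic have "orthogonal_polys a b W P \<and> (\<forall>n. mat_coeff (P n) n = mat 1)"
    unfolding orthogonal_monic_iff by blast
  then show ?thesis by (rule exI[of _ P])
qed

text \<open>The leading terms of P_n - Q_n cancel, so the difference is orthogonal to both P_n and
  Q_n, hence to itself, and definiteness applies.\<close>

lemma monic_orthogonal_unique:
  assumes W: "matrix_weight a b W"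
    and P: "orthogonal_polys a b W P \<and> (\<forall>n. mat_coeff (P n) n = mat 1)"
    and Q: "orthogonal_polys a b W Q \<and> (\<forall>n. mat_coeff (Q n) n = mat 1)"
  shows "P = Q"
proof
  fix n
  have P: "monic_of_degree k (P k)" "k \<noteq> m \<Longrightarrow> matrix_ip a b W (P k) (P m) = 0" for k m
    using P[unfolded orthogonal_monic_iff] by blast+
  have Q: "monic_of_degree k (Q k)" "k \<noteq> m \<Longrightarrow> matrix_ip a b W (Q k) (Q m) = 0" for k m
    using Q[unfolded orthogonal_monic_iff] by blast+
  let ?R = "P n - Q n"
  have R: "mat_coeff ?R k = 0" if "k \<ge> n" for k
    using that P(1)[of n] Q(1)[of n] by (cases "k = n") (auto simp: mat_coeff_diff monic_of_degree_def)
  have "matrix_ip a b W ?R (P n) = 0"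
    by (rule matrix_ip_lower_degree_eq_0[OF W, of n P]) (use P R in simp_all)
  moreover have "matrix_ip a b W ?R (Q n) = 0"
    by (rule matrix_ip_lower_degree_eq_0[OF W, of n Q]) (use Q R in simp_all)
  ultimately have "matrix_ip a b W (P n) ?R = 0" "matrix_ip a b W (Q n) ?R = 0"
    by (auto intro: matrix_ip_eq_0_commute[OF W])
  then have "?R = 0"
    by (intro matrix_ip_self_eq_0[OF W]) (simp add: matrix_ip_diff_left[OF W])
  then show "P n = Q n" by simp
qed

lemma monic_orthogonal_polys_eqI:
  assumes "matrix_weight a b W"
    and "orthogonal_polys a b W P" and "\<And>n. mat_coeff (P n) n = mat 1"
  shows "monic_orthogonal_polys a b W = P"
  unfolding monic_orthogonal_polys_def
  using assms by (intro the_equality monic_orthogonal_unique[OF assms(1)]) auto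

text \<open>Existence and uniqueness together make the \<open>THE\<close> in
  \<open>monic_orthogonal_polys\<close> denote the expected sequence.\<close>

lemma
  assumes "matrix_weight a b W"
  shows monic_orthogonal_polys_orthogonal: "orthogonal_polys a b W (monic_orthogonal_polys a b W)"
    and monic_orthogonal_polys_monic: "monic_of_degree n (monic_orthogonal_polys a b W n)"
proof -
  obtain P where P: "orthogonal_polys a b W P" "\<forall>n. mat_coeff (P n) n = mat 1"
    using monic_orthogonal_exists[OF assms] by blast
  then have "monic_orthogonal_polys a b W = P"
    by (intro monic_orthogonal_polys_eqI[OF assms]) auto
  with P orthogonal_monic_iff[of a b W P] show "orthogonal_polys a b W (monic_orthogonal_polys a b W)"
    and "monic_of_degree n (monic_orthogonal_polys a b W n)"
    by simp_all
qed

text \<open>Dividing each term by its leading coefficient from the left keeps orthogonality and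
  gives a monic sequence, which uniqueness identifies.\<close>

lemma orthogonal_polys_eq_lead_mult_monic:
  assumes W: "matrix_weight a b W" and Q: "orthogonal_polys a b W Q"
  shows "Q n = mat_const (mat_coeff (Q n) n) ** monic_orthogonal_polys a b W n"
proof -
  let ?L = "\<lambda>n. mat_coeff (Q n) n"
  obtain H where H: "\<And>n. ?L n ** H n = mat 1" "\<And>n. H n ** ?L n = mat 1"
    using Q unfolding orthogonal_polys_alt invertible_def by metis
  let ?P = "\<lambda>n. mat_const (H n) ** Q n"
  have zero: "matrix_ip a b W (Q n) (Q m) = 0" if "n \<noteq> m" for m n
    using Q that by (simp add: orthogonal_polys_alt)
  have "mat_degree (Q n) = n" for n
    using Q by (simp add: orthogonal_polys_alt)
  then have "monic_of_degree n (?P n)" for n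
    using H mat_coeff_eq_0[of "Q n"] by (simp add: monic_of_degree_def mat_coeff_const_mult)
  moreover have "matrix_ip a b W (?P n) (?P m) = 0" if "n \<noteq> m" for m n
  proof -
    \<comment> \<open>Constants are pulled out of the left argument only, so the right one is
      normalised through Hermitian symmetry.\<close>
    have "matrix_ip a b W (?P m) (Q n) = 0"
      using zero[OF that[symmetric]] by (simp add: matrix_ip_const_left[OF W])
    then have "matrix_ip a b W (Q n) (?P m) = 0"
      by (rule matrix_ip_eq_0_commute[OF W])
    then show ?thesis
      by (simp add: matrix_ip_const_left[OF W])
  qed
  ultimately have "orthogonal_polys a b W ?P \<and> (\<forall>n. mat_coeff (?P n) n = mat 1)"
    using orthogonal_monic_iff[of a b W ?P] by blast
  then have "monic_orthogonal_polys a b W = ?P"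
    by (intro monic_orthogonal_polys_eqI[OF W]) blast+
  then show ?thesis
    by (simp add: matrix_mul_assoc H flip: mat_const_mult)
qed

section \<open>Block matrices\<close>

lemma sum_UNIV_Plus:
  fixes f :: "'n1::finite + 'n2::finite \<Rightarrow> 'a::comm_monoid_add"
  shows "sum f UNIV = (\<Sum>i\<in>UNIV. f (Inl i)) + (\<Sum>i\<in>UNIV. f (Inr i))"
  using sum.Plus[of UNIV UNIV f] by simp

lemma block_diag_nth [simp]:
  "block_diag A B $ Inl k $ Inl l = A $ k $ l"
  "block_diag A B $ Inl k $ Inr m = 0"
  "block_diag A B $ Inr n $ Inl l = 0"
  "block_diag A B $ Inr n $ Inr m = B $ n $ m"
  by (simp_all add: block_diag_def)

lemma block_nth [simp]:
  "block11 A $ k $ l = A $ Inl k $ Inl l"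
  "block12 A $ k $ m = A $ Inl k $ Inr m"
  "block21 A $ n $ l = A $ Inr n $ Inl l"
  "block22 A $ n $ m = A $ Inr n $ Inr m"
  by (simp_all add: block11_def block12_def block21_def block22_def)

text \<open>A block diagonal factor on the right acts on block columns (on the left, below, on block
  rows), so the blocks never mix.\<close>

lemma block_mult_block_diag:
  "block11 (M ** block_diag A B) = block11 M ** A"
  "block12 (M ** block_diag A B) = block12 M ** B"
  "block21 (M ** block_diag A B) = block21 M ** A"
  "block22 (M ** block_diag A B) = block22 M ** B"
  by (simp_all add: vec_eq_iff matrix_mult_nth sum_UNIV_Plus)

lemma block_block_diag_mult:
  "block11 (block_diag A B ** M) = A ** block11 M"
  "block12 (block_diag A B ** M) = A ** block12 M"
  "block21 (block_diag A B ** M) = B ** block21 M"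
  "block22 (block_diag A B ** M) = B ** block22 M"
  by (simp_all add: vec_eq_iff matrix_mult_nth sum_UNIV_Plus)

lemma all_sum_iff: "(\<forall>i :: 'a + 'b. P i) \<longleftrightarrow> (\<forall>i. P (Inl i)) \<and> (\<forall>i. P (Inr i))"
  by (metis sum.exhaust)

lemma block_eq_iff:
  "M = N \<longleftrightarrow> block11 M = block11 N \<and> block12 M = block12 N \<and> block21 M = block21 N \<and> block22 M = block22 N"
  by (auto simp: vec_eq_iff all_sum_iff)

lemma block_zero [simp]: "block11 0 = 0" "block12 0 = 0" "block21 0 = 0" "block22 0 = 0"
  by (simp_all add: vec_eq_iff)

lemma block_sum:
  "block11 (sum f I) = (\<Sum>i\<in>I. block11 (f i))"
  "block12 (sum f I) = (\<Sum>i\<in>I. block12 (f i))"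
  "block21 (sum f I) = (\<Sum>i\<in>I. block21 (f i))"
  "block22 (sum f I) = (\<Sum>i\<in>I. block22 (f i))"
  by (simp_all add: vec_eq_iff)

lemma block_mat_const:
  "block11 (mat_const M) = mat_const (block11 M)"
  "block12 (mat_const M) = mat_const (block12 M)"
  "block21 (mat_const M) = mat_const (block21 M)"
  "block22 (mat_const M) = mat_const (block22 M)"
  by (simp_all add: vec_eq_iff)

lemma block_diag_mult: "block_diag A B ** block_diag C D = block_diag (A ** C) (B ** D)"
  by (simp add: vec_eq_iff all_sum_iff matrix_mult_nth sum_UNIV_Plus)

lemma ctranspose_block_diag: "ctranspose (block_diag A B) = block_diag (ctranspose A) (ctranspose B)"
  by (simp add: vec_eq_iff all_sum_iff)

lemma mat_eval_block_diag: "mat_eval (block_diag P Q) x = block_diag (mat_eval P x) (mat_eval Q x)"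
  by (simp add: vec_eq_iff all_sum_iff)

lemma mat_coeff_block_diag: "mat_coeff (block_diag P Q) k = block_diag (mat_coeff P k) (mat_coeff Q k)"
  by (simp add: vec_eq_iff all_sum_iff)

lemma mat_deriv_power_block_diag:
  "(mat_deriv ^^ n) (block_diag P Q) = block_diag ((mat_deriv ^^ n) P) ((mat_deriv ^^ n) Q)"
  by (simp add: vec_eq_iff all_sum_iff)

lemma block_diag_one: "block_diag (mat 1) (mat 1) = mat 1"
  by (simp add: vec_eq_iff all_sum_iff mat_def)

lemma block_diag_zero: "block_diag 0 0 = 0"
  by (simp add: vec_eq_iff all_sum_iff)

lemma monic_of_degree_block_diag:
  assumes "monic_of_degree n P" "monic_of_degree n Q"
  shows "monic_of_degree n (block_diag P Q)"
  using assms by (simp add: monic_of_degree_def mat_coeff_block_diag block_diag_one block_diag_zero)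

section \<open>Direct sums of weights: positivity, integrals and orthogonality\<close>

lemma cquad_form_block_diag:
  "cquad_form (block_diag A B) v =
     cquad_form A (\<chi> i. v $ Inl i) + cquad_form B (\<chi> i. v $ Inr i)"
  by (simp add: cquad_form_def matrix_vector_mult_def sum_UNIV_Plus)

lemma pos_semidef_block_diag:
  assumes "pos_semidef A" "pos_semidef B"
  shows "pos_semidef (block_diag A B)"
  using assms by (simp add: pos_semidef_def ctranspose_block_diag cquad_form_block_diag)

lemma pos_def_cquad_form_nonneg:
  assumes "pos_def A"
  shows "0 \<le> Re (cquad_form A v)"
proof (cases "v = 0")
  case True
  then show ?thesis by (simp add: cquad_form_def)
next
  case False
  then show ?thesis using assms by (simp add: pos_def_def less_imp_le)
qed

text \<open>A nonzero vector has at least one nonzero half, which contributes strictly; the other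
  half may vanish but contributes nonnegatively.\<close>

lemma pos_def_block_diag:
  assumes "pos_def A" "pos_def B"
  shows "pos_def (block_diag A B)"
  unfolding pos_def_def
proof (intro conjI allI impI)
  show "ctranspose (block_diag A B) = block_diag A B"
    using assms by (simp add: pos_def_def ctranspose_block_diag)
  fix v :: "complex^('a + 'b)"
  assume "v \<noteq> 0"
  let ?v1 = "\<chi> i. v $ Inl i" and ?v2 = "\<chi> i. v $ Inr i"
  have ne: "?v1 \<noteq> 0 \<or> ?v2 \<noteq> 0"
    using \<open>v \<noteq> 0\<close> by (auto simp: vec_eq_iff all_sum_iff)
  have "0 \<le> Re (cquad_form A ?v1)" "0 \<le> Re (cquad_form B ?v2)"
    using assms by (simp_all add: pos_def_cquad_form_nonneg)
  moreover have "0 < Re (cquad_form A ?v1) \<or> 0 < Re (cquad_form B ?v2)"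
    using ne assms unfolding pos_def_def by blast
  ultimately show "0 < Re (cquad_form (block_diag A B) v)"
    by (auto simp: cquad_form_block_diag)
qed

lemma linear_block_diag_left: "linear (\<lambda>A :: complex^'n1^'n1. block_diag A (0 :: complex^'n2^'n2))"
  by (rule linearI) (simp_all add: vec_eq_iff all_sum_iff)

lemma linear_block_diag_right: "linear (\<lambda>B :: complex^'n2^'n2. block_diag (0 :: complex^'n1^'n1) B)"
  by (rule linearI) (simp_all add: vec_eq_iff all_sum_iff)

lemma block_diag_eq_add:
  fixes A :: "complex^'n1^'n1" and B :: "complex^'n2^'n2"
  shows "block_diag A B = block_diag A 0 + block_diag 0 B"
  by (simp add: vec_eq_iff all_sum_iff)

text \<open>Each diagonal block enters through a linear embedding that commutes with the integral,
  and the two images are added.\<close>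

lemma set_integrable_block_diag:
  fixes f :: "'x \<Rightarrow> complex^'n1^'n1" and g :: "'x \<Rightarrow> complex^'n2^'n2"
  assumes "set_integrable M A f" and "set_integrable M A g"
  shows "set_integrable M A (\<lambda>x. block_diag (f x) (g x))"
    and "(LINT x:A|M. block_diag (f x) (g x)) = block_diag (LINT x:A|M. f x) (LINT x:A|M. g x)"
proof -
  let ?L = "\<lambda>A. block_diag A (0 :: complex^'n2^'n2)" and ?R = "block_diag (0 :: complex^'n1^'n1)"
  have L: "linear ?L" and R: "linear ?R"
    by (rule linear_block_diag_left linear_block_diag_right)+
  note f = set_integrable_linear_image[OF L assms(1)]
    and g = set_integrable_linear_image[OF R assms(2)]
  have eq: "block_diag A B = ?L A + ?R B" for A B
    by (rule block_diag_eq_add)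
  show "set_integrable M A (\<lambda>x. block_diag (f x) (g x))"
    and "(LINT x:A|M. block_diag (f x) (g x)) = block_diag (LINT x:A|M. f x) (LINT x:A|M. g x)"
    unfolding eq[of "f _" "g _"] eq[of "set_lebesgue_integral M A f" "set_lebesgue_integral M A g"]
    using set_integral_add[OF f(1) g(1)] f(2) g(2) by simp_all
qed

lemma matrix_weight_weight_sum:
  assumes "matrix_weight a b W1" and "matrix_weight a b W2"
  shows "matrix_weight a b (weight_sum W1 W2)"
proof -
  have "AE x in lebesgue. x \<in> einterval a b \<longrightarrow> pos_def (W1 x)"
    "AE x in lebesgue. x \<in> einterval a b \<longrightarrow> pos_def (W2 x)"
    using assms by (simp_all add: matrix_weight_def)
  then have "AE x in lebesgue. x \<in> einterval a b \<longrightarrow> pos_def (weight_sum W1 W2 x)"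
    by eventually_elim (auto simp: weight_sum_def intro: pos_def_block_diag)
  moreover have "x ^ n *\<^sub>R weight_sum W1 W2 x = block_diag (x ^ n *\<^sub>R W1 x) (x ^ n *\<^sub>R W2 x)" for n x
    by (simp add: weight_sum_def vec_eq_iff all_sum_iff)
  ultimately show ?thesis
    using assms
    by (auto simp: matrix_weight_def set_integrable_block_diag weight_sum_def[of W1 W2] pos_semidef_block_diag)
qed

lemma matrix_ip_weight_sum:
  assumes "matrix_weight a b W1" and "matrix_weight a b W2"
  shows "matrix_ip a b (weight_sum W1 W2) (block_diag P1 P2) (block_diag Q1 Q2) =
    block_diag (matrix_ip a b W1 P1 Q1) (matrix_ip a b W2 P2 Q2)"
  using set_integrable_block_diag(2)[OF matrix_weight_ip_integrable[OF assms(1), of P1 Q1]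
      matrix_weight_ip_integrable[OF assms(2), of P2 Q2]]
  by (simp add: matrix_ip_def weight_sum_def mat_eval_block_diag ctranspose_block_diag block_diag_mult)

text \<open>The inner product of block diagonal polynomials is block diagonal, so the diagonal
  sequence is monic and orthogonal for the sum.\<close>

lemma monic_orthogonal_polys_weight_sum:
  fixes W1 :: "real \<Rightarrow> complex^'n1^'n1" and W2 :: "real \<Rightarrow> complex^'n2^'n2"
  assumes W1: "matrix_weight a b W1" and W2: "matrix_weight a b W2"
  shows "monic_orthogonal_polys a b (weight_sum W1 W2) n =
    block_diag (monic_orthogonal_polys a b W1 n) (monic_orthogonal_polys a b W2 n)"
proof -
  let ?P = "\<lambda>n. block_diag (monic_orthogonal_polys a b W1 n) (monic_orthogonal_polys a b W2 n)"
  have "\<forall>n. monic_of_degree n (?P n)"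
    by (simp add: monic_of_degree_block_diag monic_orthogonal_polys_monic W1 W2)
  moreover have "\<forall>n m. n \<noteq> m \<longrightarrow> matrix_ip a b (weight_sum W1 W2) (?P n) (?P m) = 0"
    using monic_orthogonal_polys_orthogonal[OF W1] monic_orthogonal_polys_orthogonal[OF W2]
    by (simp add: matrix_ip_weight_sum[OF W1 W2] orthogonal_polys_alt block_diag_zero)
  ultimately have "orthogonal_polys a b (weight_sum W1 W2) ?P \<and> (\<forall>n. mat_coeff (?P n) n = mat 1)"
    unfolding orthogonal_monic_iff by blast
  then have "monic_orthogonal_polys a b (weight_sum W1 W2) = ?P"
    by (intro monic_orthogonal_polys_eqI[OF matrix_weight_weight_sum[OF W1 W2]]) blast+
  then show ?thesis by simp
qed

section \<open>Differential operators and monic orthogonal polynomials\<close>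

text \<open>Lets operators of different degrees be summed over a common range.\<close>

lemma op_apply_eq_sum:
  assumes "degree D \<le> N"
  shows "op_apply Q D = (\<Sum>i\<le>N. (mat_deriv ^^ i) Q ** coeff D i)"
  unfolding op_apply_def
proof (rule sum.mono_neutral_left)
  show "\<forall>i\<in>{..N} - {..degree D}. (mat_deriv ^^ i) Q ** coeff D i = 0"
    by (simp add: coeff_eq_0 not_le vec_eq_iff matrix_mult_nth)
qed (use assms in auto)

lemma matrix_mult_sum_right:
  fixes A :: "'a::semiring_1^'n^'m" and F :: "'i \<Rightarrow> 'a^'k^'n"
  shows "A ** (\<Sum>i\<in>I. F i) = (\<Sum>i\<in>I. A ** F i)"
  by (simp add: vec_eq_iff matrix_mult_nth sum_distrib_left) (intro allI, rule sum.swap)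


text \<open>Operators act from the right, so constant matrices on the left pass through derivatives
  and coefficients.\<close>

lemma op_apply_const_mult: "op_apply (mat_const C ** P) D = mat_const C ** op_apply P D"
proof -
  have "(mat_deriv ^^ i) (mat_const C ** P) = mat_const C ** (mat_deriv ^^ i) P" for i
    by (simp add: vec_eq_iff matrix_mult_nth higher_pderiv_sum higher_pderiv_smult)
  then show ?thesis
    by (simp add: op_apply_def matrix_mult_sum_right matrix_mul_assoc)
qed

text \<open>Any orthogonal sequence is L_n P_n with L_n invertible, so passing to it only conjugates
  the eigenvalue matrix by L_n.\<close>

lemma diff_alg_iff_monic:
  assumes W: "matrix_weight a b W"
  shows "D \<in> diff_alg a b W \<longleftrightarrow> (\<forall>n. \<exists>\<Gamma>. op_apply (monic_orthogonal_polys a b W n) D =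
    mat_const \<Gamma> ** monic_orthogonal_polys a b W n)" (is "_ \<longleftrightarrow> ?monic")
proof
  assume "D \<in> diff_alg a b W"
  then show ?monic
    using monic_orthogonal_polys_orthogonal[OF W] by (auto simp: diff_alg_def)
next
  let ?P = "monic_orthogonal_polys a b W"
  assume monic: ?monic
  have "\<exists>\<Gamma>. op_apply (Q n) D = mat_const \<Gamma> ** Q n" if Q: "orthogonal_polys a b W Q" for Q n
  proof -
    let ?L = "mat_coeff (Q n) n"
    obtain H where "H ** ?L = mat 1"
      using Q unfolding orthogonal_polys_def invertible_def by metis
    obtain \<Gamma> where \<Gamma>: "op_apply (?P n) D = mat_const \<Gamma> ** ?P n"
      using monic by blast
    have QP: "Q n = mat_const ?L ** ?P n"
      by (rule orthogonal_polys_eq_lead_mult_monic[OF W Q])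
    have PQ: "mat_const H ** Q n = ?P n"
      by (subst QP) (simp add: matrix_mul_assoc \<open>H ** ?L = mat 1\<close> flip: mat_const_mult)
    have "op_apply (Q n) D = mat_const ?L ** (mat_const \<Gamma> ** (mat_const H ** Q n))"
      unfolding PQ by (subst QP) (simp only: op_apply_const_mult \<Gamma>)
    also have "\<dots> = mat_const (?L ** \<Gamma> ** H) ** Q n"
      by (simp add: mat_const_mult matrix_mul_assoc)
    finally show ?thesis ..
  qed
  then show "D \<in> diff_alg a b W"
    by (simp add: diff_alg_def)
qed

section \<open>Degree bounds forced by the eigenvalue equations\<close>

lemma mat_degree_const_mult_le: "mat_degree (mat_const C ** P) \<le> mat_degree P"
proof -
  have "mat_degree (mat_const C) = 0"
    using mat_degree_le_iff[of "mat_const C" 0] by simp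
  then show ?thesis
    using mat_degree_mult_le[of "mat_const C" P] by simp
qed

text \<open>Differentiating \<open>n\<close> times shifts coefficients down by \<open>n\<close>, so
  only the leading one survives, with factor \<open>pochhammer 1 n\<close>, which is n!.\<close>

lemma monic_deriv_power:
  assumes "monic_of_degree n P"
  shows "(mat_deriv ^^ n) P = mat [:fact n:]"
proof (rule matrix_poly_eqI)
  fix k
  have "mat_coeff P (n + k) = (if k = 0 then mat 1 else 0)"
    using assms by (simp add: monic_of_degree_def)
  then have "mat_coeff P (n + k) $ i $ j = (if k = 0 \<and> i = j then 1 else 0)" for i j
    by (simp only:) (simp add: mat_def)
  then have "coeff (P $ i $ j) (n + k) = (if k = 0 \<and> i = j then 1 else 0)" for i j
    by simp
  then show "mat_coeff ((mat_deriv ^^ n) P) k = mat_coeff (mat [:fact n:]) k"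
    by (cases k) (simp_all add: vec_eq_iff mat_def coeff_higher_pderiv pochhammer_fact add.commute)
qed

text \<open>The \<open>n\<close>-th derivative of \<open>P n\<close> is \<open>n! I\<close> and the higher ones vanish, so
  \<open>n! F\<^sub>n\<close> is the image of \<open>P n\<close> minus terms that only involve \<open>F\<^sub>i\<close> with \<open>i < n\<close>.\<close>

lemma degree_bounded_opsI:
  fixes D :: "('m::finite, 'n::finite) matrix_diff_op"
  assumes monic: "\<And>n. monic_of_degree n (P n)"
    and le: "\<And>n. mat_degree (op_apply (P n) D) \<le> n"
  shows "D \<in> degree_bounded_ops"
proof -
  have "mat_degree (coeff D n) \<le> n" for n
  proof (induction n rule: less_induct)
    case (less n)
    let ?T = "\<lambda>i. (mat_deriv ^^ i) (P n) ** coeff D i"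
    have deg: "mat_degree (P n) = n"
      using monic by (simp add: monic_of_degree_iff)
    have top: "?T i = 0" if "i > n" for i
    proof -
      have "degree (P n $ r $ c) < i" for r c
        using that mat_degree_le_iff[of "P n" n] deg by (auto intro: le_less_trans)
      then have "(mat_deriv ^^ i) (P n) = 0"
        by (simp add: vec_eq_iff poly_eq_iff coeff_higher_pderiv coeff_eq_0 trans_less_add2 trans_less_add1)
      then show ?thesis
        by (simp add: vec_eq_iff matrix_mult_nth)
    qed
    \<comment> \<open>\<open>degree D\<close> may lie on either side of \<open>n\<close>; the
      maximum ensures that the term \<open>?T n\<close> is in the sum.\<close>
    have "op_apply (P n) D = (\<Sum>i\<le>max n (degree D). ?T i)"
      by (rule op_apply_eq_sum) simp
    also have "\<dots> = (\<Sum>i\<le>n. ?T i)"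
      using top by (intro sum.mono_neutral_right) auto
    also have "\<dots> = (\<Sum>i<n. ?T i) + ?T n"
      by (simp flip: lessThan_Suc_atMost)
    finally have T: "?T n = op_apply (P n) D - (\<Sum>i<n. ?T i)"
      by simp
    \<comment> \<open>Differentiation lowers the degree by \<open>i\<close>, and by induction
      \<open>coeff D i\<close> restores at most \<open>i\<close>.\<close>
    have "mat_degree (?T i) \<le> n" if "i < n" for i
    proof -
      have "mat_degree (?T i) \<le> (n - i) + i"
        using mat_degree_mult_le[of "(mat_deriv ^^ i) (P n)" "coeff D i"]
          mat_degree_deriv_power_le[of i "P n"] less.IH[OF that] deg by linarith
      then show ?thesis using that by simp
    qed
    then have "mat_coeff (\<Sum>i<n. ?T i) k = 0" if "k > n" for k
      using that mat_degree_le_iff_coeff[of "?T _" n] by (simp add: vec_eq_iff coeff_sum)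
    then have "mat_degree (?T n) \<le> n"
      using le[of n] unfolding T mat_degree_le_iff_coeff by (simp add: mat_coeff_diff)
    \<comment> \<open>The factor n! is a nonzero scalar, so the degree bound passes from
      \<open>?T n\<close> to \<open>coeff D n\<close>.\<close>
    moreover have "?T n $ i $ j = smult (fact n) (coeff D n $ i $ j)" for i j
      by (simp add: monic_deriv_power[OF monic] matrix_mult_nth mat_def
          if_distrib[of "\<lambda>x. x * _"] cong: if_cong)
    ultimately show "mat_degree (coeff D n) \<le> n"
      by (simp add: mat_degree_le_iff)
  qed
  then show ?thesis
    by (simp add: degree_bounded_ops_def)
qed

text \<open>The degree condition follows from the equations: a constant matrix times the monic
  polynomial of degree \<open>n\<close> for \<open>W2\<close> has degree at most
  \<open>n\<close>.\<close>

lemma diff_mod_iff: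
  assumes W1: "matrix_weight a b W1" and W2: "matrix_weight a b W2"
  shows "D \<in> diff_mod a b W1 W2 \<longleftrightarrow> (\<forall>n. \<exists>\<Lambda>. op_apply (monic_orthogonal_polys a b W1 n) D =
    mat_const \<Lambda> ** monic_orthogonal_polys a b W2 n)" (is "_ \<longleftrightarrow> ?R")
proof -
  have "D \<in> degree_bounded_ops" if R: ?R
  proof (rule degree_bounded_opsI)
    show "monic_of_degree n (monic_orthogonal_polys a b W1 n)" for n
      by (rule monic_orthogonal_polys_monic[OF W1])
    fix n
    obtain \<Lambda> where "op_apply (monic_orthogonal_polys a b W1 n) D =
        mat_const \<Lambda> ** monic_orthogonal_polys a b W2 n"
      using R by blast
    then show "mat_degree (op_apply (monic_orthogonal_polys a b W1 n) D) \<le> n"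
      using mat_degree_const_mult_le[of \<Lambda> "monic_orthogonal_polys a b W2 n"]
        monic_orthogonal_polys_monic[OF W2, of n] by (simp add: monic_of_degree_iff)
  qed
  then show ?thesis
    by (auto simp: diff_mod_def)
qed

section \<open>Splitting an operator into its blocks\<close>

lemma degree_map_poly_le:
  assumes "f 0 = 0"
  shows "degree (map_poly f p) \<le> degree p"
  using assms by (intro degree_le) (simp add: coeff_map_poly coeff_eq_0)

text \<open>A block of an operator may have smaller degree than the operator, so the sum is taken up
  to \<open>degree D\<close> for all four blocks alike.\<close>

lemma op_apply_map_poly:
  assumes "f 0 = 0"
  shows "op_apply P (map_poly f D) = (\<Sum>i\<le>degree D. (mat_deriv ^^ i) P ** f (coeff D i))"
  using assms by (simp add: op_apply_eq_sum[OF degree_map_poly_le] coeff_map_poly)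

text \<open>Derivatives of a block diagonal polynomial stay block diagonal, so the row of a block
  decides whether it is applied to \<open>P\<close> or to \<open>Q\<close>.\<close>

lemma block_op_apply_block_diag:
  "block11 (op_apply (block_diag P Q) D) = op_apply P (map_poly block11 D)"
  "block12 (op_apply (block_diag P Q) D) = op_apply P (map_poly block12 D)"
  "block21 (op_apply (block_diag P Q) D) = op_apply Q (map_poly block21 D)"
  "block22 (op_apply (block_diag P Q) D) = op_apply Q (map_poly block22 D)"
  unfolding op_apply_map_poly[of block11, OF block_zero(1)] op_apply_map_poly[of block12, OF block_zero(2)]
    op_apply_map_poly[of block21, OF block_zero(3)] op_apply_map_poly[of block22, OF block_zero(4)]
  by (simp_all only: op_apply_def block_sum mat_deriv_power_block_diag block_block_diag_mult)

text \<open>Used to assemble independently found eigenvalue matrices into a single one.\<close>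

lemma ex_block_matrix:
  "\<exists>M :: 'a^('n1::finite + 'n2::finite)^('n1 + 'n2).
     block11 M = A \<and> block12 M = B \<and> block21 M = C \<and> block22 M = D"
  by (rule exI[of _ "\<chi> i j. case i of
        Inl k \<Rightarrow> (case j of Inl l \<Rightarrow> A $ k $ l | Inr m \<Rightarrow> B $ k $ m)
      | Inr n \<Rightarrow> (case j of Inl l \<Rightarrow> C $ n $ l | Inr m \<Rightarrow> D $ n $ m)"])
    (simp add: vec_eq_iff)

lemma op_apply_block_diag_iff:
  "(\<exists>\<Gamma>. op_apply (block_diag P Q) D = mat_const \<Gamma> ** block_diag P Q) \<longleftrightarrow>
     (\<exists>A. op_apply P (map_poly block11 D) = mat_const A ** P) \<and>
     (\<exists>A. op_apply P (map_poly block12 D) = mat_const A ** Q) \<and>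
     (\<exists>A. op_apply Q (map_poly block21 D) = mat_const A ** P) \<and>
     (\<exists>A. op_apply Q (map_poly block22 D) = mat_const A ** Q)"
  (is "?L \<longleftrightarrow> ?R")
proof -
  \<comment> \<open>Each block of \<open>\<Gamma>\<close> occurs in exactly one of the four
    equations, so the existence claims can be treated separately.\<close>
  have eq: "op_apply (block_diag P Q) D = mat_const \<Gamma> ** block_diag P Q \<longleftrightarrow>
     op_apply P (map_poly block11 D) = mat_const (block11 \<Gamma>) ** P \<and>
     op_apply P (map_poly block12 D) = mat_const (block12 \<Gamma>) ** Q \<and>
     op_apply Q (map_poly block21 D) = mat_const (block21 \<Gamma>) ** P \<and>
     op_apply Q (map_poly block22 D) = mat_const (block22 \<Gamma>) ** Q" for \<Gamma>
    by (subst block_eq_iff)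
      (simp only: block_op_apply_block_diag block_mult_block_diag block_mat_const)
  show ?thesis
  proof
    assume ?L
    then show ?R unfolding eq by blast
  next
    assume ?R
    then obtain A B C E where
      "op_apply P (map_poly block11 D) = mat_const A ** P"
      "op_apply P (map_poly block12 D) = mat_const B ** Q"
      "op_apply Q (map_poly block21 D) = mat_const C ** P"
      "op_apply Q (map_poly block22 D) = mat_const E ** Q"
      by blast
    moreover obtain M where "block11 M = A" "block12 M = B" "block21 M = C" "block22 M = E"
      using ex_block_matrix[of A B C E] by blast
    ultimately show ?L
      unfolding eq by (intro exI[of _ M]) simp
  qed
qed

theorem proposition3p3:
  fixes a b :: ereal
    and W1 :: "real \<Rightarrow> complex^'n1^'n1"
    and W2 :: "real \<Rightarrow> complex^'n2^'n2"
  assumes "matrix_weight a b W1"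
    and "matrix_weight a b W2"
  shows "diff_alg a b (weight_sum W1 W2) =
    {D. map_poly block11 D \<in> diff_alg a b W1 \<and>
        map_poly block12 D \<in> diff_mod a b W1 W2 \<and>
        map_poly block21 D \<in> diff_mod a b W2 W1 \<and>
        map_poly block22 D \<in> diff_alg a b W2}"
proof -
  \<comment> \<open>These equivalences turn all five memberships into equations for every
    \<open>n\<close> in the monic polynomials; the splitting for fixed \<open>n\<close> then only
    has to be distributed over the universal quantifier.\<close>
  note iff = diff_alg_iff_monic[OF assms(1)] diff_alg_iff_monic[OF assms(2)]
    diff_alg_iff_monic[OF matrix_weight_weight_sum[OF assms]]
    diff_mod_iff[OF assms] diff_mod_iff[OF assms(2,1)]
  show ?thesis
    by (intro set_eqI) (simp only: mem_Collect_eq iff monic_orthogonal_polys_weight_sum[OF assms]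
        op_apply_block_diag_iff all_conj_distrib)
qed

end
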